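(* For every heavy graph parameter $\rho$ and every integer $c$, the $(\rho,c)$-modulator number $\mu_{\rho,c}$ (with its canonical hyperparameterisation) is awesome; that is, a graph class has clique-bounded $\mu_{\rho,c}$ if and only if it has bounded $\alpha\text{-}\mu_{\rho,c}$.
   Context: All graphs are finite, simple and undirected; $\alpha,\omega$ denote independence and clique number. A graph class is a set of graphs closed under isomorphism. A graph parameter is heavy if it is monotone under induced subgraphs (its value on an induced subgraph of $G$ is at most its value on $G$) and unbounded on the class of complete graphs. For a graph parameter $\rho$ and integer $c$, a set $S\subseteq V(G)$ is a $(\rho,c)$-modulator of $G$ if $\rho(G-S)\le c$; $\mu_{\rho,c}(G)$ is the minimum $|S|$ over all $(\rho,c)$-modulators $S$ of $G$, and its independence variant $\alpha\text{-}\mu_{\rho,c}(G)$ is the minimum of $\alpha(G[S])$ over all $(\rho,c)$-modulators $S$ of $G$. For a graph parameter $\sigma$, a class $\mathcal G$ has bounded $\sigma$ if there is an integer $k$ with $\sigma(G')\le k$ for every induced subgraph $G'$ of every $G\in\mathcal G$; it has clique-bounded $\sigma$ if there is a nondecreasing $f$ with $\sigma(G')\le f(\omega(G'))$ for all such $G'$. *)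

theory Defs
  imports "HOL-Library.Ramsey" "HOL-Library.Extended_Real" "HOL-Library.Infinite_Typeclass"
begin

text \<open>
  A graph is a pair of a vertex set and a set of 2-element edges. Over an infinite vertex type every
  finite simple graph has an isomorphic copy. The definitions below are meaningful for pairs
  satisfying \<^term>\<open>fin_graph\<close>; \<^const>\<open>clique\<close>, \<^const>\<open>indep\<close> and \<^const>\<open>nsets\<close> come from
  \<^theory>\<open>HOL-Library.Ramsey\<close>.
\<close>

type_synonym 'a graph = "'a set \<times> 'a set set"

abbreviation verts :: "'a graph \<Rightarrow> 'a set" where "verts G \<equiv> fst G"
abbreviation edges :: "'a graph \<Rightarrow> 'a set set" where "edges G \<equiv> snd G"

definition fin_graph :: "'a graph \<Rightarrow> bool" where
  "fin_graph G \<longleftrightarrow> finite (verts G) \<and> edges G \<subseteq> [verts G]\<^bsup>2\<^esup>"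

definition graph_iso :: "'a graph \<Rightarrow> 'a graph \<Rightarrow> bool" where
  "graph_iso G H \<longleftrightarrow> (\<exists>\<phi>. bij_betw \<phi> (verts G) (verts H) \<and>
     (\<forall>u\<in>verts G. \<forall>v\<in>verts G. {u, v} \<in> edges G \<longleftrightarrow> {\<phi> u, \<phi> v} \<in> edges H))"

definition induce :: "'a graph \<Rightarrow> 'a set \<Rightarrow> 'a graph" where
  "induce G S = (S, {e \<in> edges G. e \<subseteq> S})"

definition complete_graph :: "'a graph \<Rightarrow> bool" where
  "complete_graph G \<longleftrightarrow> finite (verts G) \<and> edges G = [verts G]\<^bsup>2\<^esup>"

definition independence_number :: "'a graph \<Rightarrow> nat" where
  "independence_number G = Max {card I | I. I \<subseteq> verts G \<and> indep I (edges G)}"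

definition clique_number :: "'a graph \<Rightarrow> nat" where
  "clique_number G = Max {card K | K. K \<subseteq> verts G \<and> clique K (edges G)}"

definition graph_class :: "'a graph set \<Rightarrow> bool" where
  "graph_class \<G> \<longleftrightarrow> (\<forall>G\<in>\<G>. fin_graph G) \<and>
     (\<forall>G\<in>\<G>. \<forall>H. fin_graph H \<and> graph_iso G H \<longrightarrow> H \<in> \<G>)"

text \<open>
  Parameters take extended real values. This covers integer- and real-valued parameters, and lets a
  modulator number be \<open>\<infinity>\<close> when no modulator exists.
\<close>

definition graph_parameter :: "('a graph \<Rightarrow> ereal) \<Rightarrow> bool" where
  "graph_parameter \<rho> \<longleftrightarrow>
     (\<forall>G H. fin_graph G \<and> fin_graph H \<and> graph_iso G H \<longrightarrow> \<rho> G = \<rho> H)"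

definition heavy :: "('a graph \<Rightarrow> ereal) \<Rightarrow> bool" where
  "heavy \<rho> \<longleftrightarrow>
     (\<forall>G S. fin_graph G \<and> S \<subseteq> verts G \<longrightarrow> \<rho> (induce G S) \<le> \<rho> G) \<and>
     (\<forall>k::int. \<exists>G. complete_graph G \<and> \<rho> G > ereal (real_of_int k))"

definition modulator :: "('a graph \<Rightarrow> ereal) \<Rightarrow> int \<Rightarrow> 'a graph \<Rightarrow> 'a set \<Rightarrow> bool" where
  "modulator \<rho> c G S \<longleftrightarrow> S \<subseteq> verts G \<and> \<rho> (induce G (verts G - S)) \<le> ereal (real_of_int c)"

text \<open>
  The infima range over sets of natural numbers, so they are minima unless the set of modulators
  is empty, in which case they are \<open>\<infinity>\<close>.
\<close>

definition modulator_number :: "('a graph \<Rightarrow> ereal) \<Rightarrow> int \<Rightarrow> 'a graph \<Rightarrow> ereal" where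
  "modulator_number \<rho> c G = (INF S\<in>{S. modulator \<rho> c G S}. ereal (real (card S)))"

definition indep_modulator_number :: "('a graph \<Rightarrow> ereal) \<Rightarrow> int \<Rightarrow> 'a graph \<Rightarrow> ereal" where
  "indep_modulator_number \<rho> c G =
     (INF S\<in>{S. modulator \<rho> c G S}. ereal (real (independence_number (induce G S))))"

definition has_bounded :: "('a graph \<Rightarrow> ereal) \<Rightarrow> 'a graph set \<Rightarrow> bool" where
  "has_bounded \<sigma> \<G> \<longleftrightarrow>
     (\<exists>k::int. \<forall>G\<in>\<G>. \<forall>S\<subseteq>verts G. \<sigma> (induce G S) \<le> ereal (real_of_int k))"

definition has_clique_bounded :: "('a graph \<Rightarrow> ereal) \<Rightarrow> 'a graph set \<Rightarrow> bool" where
  "has_clique_bounded \<sigma> \<G> \<longleftrightarrow>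
     (\<exists>f::nat \<Rightarrow> nat. mono f \<and>
        (\<forall>G\<in>\<G>. \<forall>S\<subseteq>verts G. \<sigma> (induce G S) \<le> ereal (real (f (clique_number (induce G S))))))"

end

theory Submission
  imports Defs
begin

text \<open>
  If \<open>\<rho>\<close> exceeds \<open>c\<close> on the clique with \<open>n\<close> vertices, then every graph with \<open>\<rho> \<le> c\<close> has clique number
  less than \<open>n\<close>. Assume that \<open>\<mu> \<le> f(\<omega>)\<close> holds hereditarily, and let \<open>J\<close> be a vertex set of maximum
  size with \<open>\<rho>(G[J]) \<le> c\<close>. An independent set \<open>I\<close> outside \<open>J\<close> adds at most one vertex to a clique, so
  \<open>\<omega>(G[I \<union> J]) \<le> n\<close> and \<open>G[I \<union> J]\<close> has a modulator with at most \<open>f(n)\<close> vertices. By the choice of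
  \<open>J\<close>, that modulator has at least \<open>|I|\<close> vertices. So the complement of \<open>J\<close> is a modulator with
  independence number at most \<open>f(n)\<close>. The converse is Ramsey's theorem applied to a modulator.
\<close>

lemma verts_induce [simp]: "verts (induce G S) = S"
  by (simp add: induce_def)

lemma induce_induce: "T \<subseteq> S \<Longrightarrow> induce (induce G S) T = induce G T"
  by (auto simp: induce_def)

lemma fin_graph_induce: "fin_graph G \<Longrightarrow> S \<subseteq> verts G \<Longrightarrow> fin_graph (induce G S)"
  by (auto simp: fin_graph_def induce_def nsets_def intro: finite_subset)

lemma clique_induce: "K \<subseteq> S \<Longrightarrow> clique K (edges (induce G S)) \<longleftrightarrow> clique K (edges G)"
  by (auto simp: clique_def induce_def)

lemma indep_induce: "I \<subseteq> S \<Longrightarrow> indep I (edges (induce G S)) \<longleftrightarrow> indep I (edges G)"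
  by (auto simp: indep_def induce_def)

lemma card_le_clique_number:
  assumes "finite (verts G)" "K \<subseteq> verts G" "clique K (edges G)"
  shows "card K \<le> clique_number G"
  unfolding clique_number_def using assms by (intro Max_ge) auto

lemma clique_number_le:
  assumes "finite (verts G)" "\<And>K. K \<subseteq> verts G \<Longrightarrow> clique K (edges G) \<Longrightarrow> card K \<le> k"
  shows "clique_number G \<le> k"
proof -
  \<comment> \<open>The empty clique makes the family nonempty, so that \<open>Max\<close> is
    attained.\<close>
  have "{card K |K. K \<subseteq> verts G \<and> clique K (edges G)} \<noteq> {}"
    using null_clique by blast
  with assms show ?thesis
    unfolding clique_number_def by (subst Max_le_iff) auto
qed

lemma card_le_independence_number:
  assumes "finite (verts G)" "I \<subseteq> verts G" "indep I (edges G)"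
  shows "card I \<le> independence_number G"
  unfolding independence_number_def using assms by (intro Max_ge) auto

lemma independence_number_le:
  assumes "finite (verts G)" "\<And>I. I \<subseteq> verts G \<Longrightarrow> indep I (edges G) \<Longrightarrow> card I \<le> k"
  shows "independence_number G \<le> k"
proof -
  have "{card I |I. I \<subseteq> verts G \<and> indep I (edges G)} \<noteq> {}"
    using null_indep by blast
  with assms show ?thesis
    unfolding independence_number_def by (subst Max_le_iff) auto
qed

lemma complete_graph_induce_clique:
  assumes "fin_graph G" "K \<subseteq> verts G" "clique K (edges G)"
  shows "complete_graph (induce G K)"
proof -
  have "e \<in> edges G" if "e \<subseteq> K" "card e = 2" for e
    using that assms(3) by (auto simp: clique_def card_2_iff)
  with assms(1,2) show ?thesis
    by (auto simp: complete_graph_def fin_graph_def induce_def nsets_def intro: finite_subset)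
qed

lemma complete_graph_fin_graph: "complete_graph G \<Longrightarrow> fin_graph G"
  by (simp add: complete_graph_def fin_graph_def)

lemma complete_graph_iso:
  assumes "complete_graph G" "complete_graph H" "card (verts G) = card (verts H)"
  shows "graph_iso G H"
proof -
  obtain \<phi> where \<phi>: "bij_betw \<phi> (verts G) (verts H)"
    using assms finite_same_card_bij unfolding complete_graph_def by blast
  have "{u, v} \<in> edges G \<longleftrightarrow> {\<phi> u, \<phi> v} \<in> edges H" if "u \<in> verts G" "v \<in> verts G" for u v
  proof -
    \<comment> \<open>\<open>u = v\<close> is allowed here. In a complete graph
      \<open>{u, v}\<close> is an edge exactly when \<open>u \<noteq> v\<close>, so injectivity of
      \<open>\<phi>\<close> settles both cases.\<close>
    have "\<phi> u \<in> verts H" "\<phi> v \<in> verts H" "\<phi> u = \<phi> v \<longleftrightarrow> u = v"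
      using \<phi> that by (auto simp: bij_betw_def inj_on_eq_iff)
    with assms that show ?thesis
      by (auto simp: complete_graph_def nsets_def card_insert_if)
  qed
  with \<phi> show ?thesis
    unfolding graph_iso_def by blast
qed

text \<open>Take \<open>n\<close> to be the order of a complete graph \<open>Q\<close> with
  \<open>\<rho> Q > c\<close>. A clique with at least \<open>n\<close> vertices can be cut down to
  one inducing a copy of \<open>Q\<close>; isomorphism invariance and monotonicity would then force
  \<open>\<rho> G > c\<close>.\<close>

lemma heavy_clique_bound:
  fixes \<rho> :: "'a graph \<Rightarrow> ereal" and c :: int
  assumes "graph_parameter \<rho>" "heavy \<rho>"
  obtains n where "\<And>G K. fin_graph G \<Longrightarrow> \<rho> G \<le> ereal (real_of_int c) \<Longrightarrow> K \<subseteq> verts G \<Longrightarrow>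
    clique K (edges G) \<Longrightarrow> card K < n"
proof -
  obtain Q where Q: "complete_graph Q" "\<rho> Q > ereal (real_of_int c)"
    using assms(2) unfolding heavy_def by blast
  have "card K < card (verts Q)"
    if G: "fin_graph G" "\<rho> G \<le> ereal (real_of_int c)" and K: "K \<subseteq> verts G" "clique K (edges G)"
    for G K
  proof (rule ccontr)
    assume "\<not> card K < card (verts Q)"
    then obtain L where L: "L \<subseteq> K" "card L = card (verts Q)"
      by (meson not_less obtain_subset_with_card_n)
    have LG: "L \<subseteq> verts G" and "clique L (edges G)"
      using L K by (auto simp: clique_def)
    then have C: "complete_graph (induce G L)"
      using complete_graph_induce_clique G(1) by blast
    then have "graph_iso (induce G L) Q"
      using complete_graph_iso Q(1) L(2) by (metis verts_induce)
    then have "\<rho> (induce G L) = \<rho> Q"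
      using assms(1) C Q(1) complete_graph_fin_graph unfolding graph_parameter_def by blast
    moreover have "\<rho> (induce G L) \<le> \<rho> G"
      using assms(2) G(1) LG unfolding heavy_def by blast
    ultimately show False
      using Q(2) G(2) by (metis leD order_trans)
  qed
  then show thesis
    using that by blast
qed

text \<open>For natural values, an infimum at most \<open>k\<close> lies strictly below
  \<open>k + 1\<close>, and a strict upper bound on an infimum is witnessed by an element. If
  \<open>A\<close> is empty the infimum is \<infinity> and both sides are false.\<close>

lemma INF_ereal_nat_le_iff:
  fixes g :: "'b \<Rightarrow> nat"
  shows "(INF x\<in>A. ereal (real (g x))) \<le> ereal (real k) \<longleftrightarrow> (\<exists>x\<in>A. g x \<le> k)"
proof
  assume "(INF x\<in>A. ereal (real (g x))) \<le> ereal (real k)"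
  also have "\<dots> < ereal (real (Suc k))"
    by simp
  finally show "\<exists>x\<in>A. g x \<le> k"
    unfolding INF_less_iff less_ereal.simps of_nat_less_iff by (auto simp: less_Suc_eq_le)
next
  assume "\<exists>x\<in>A. g x \<le> k"
  then show "(INF x\<in>A. ereal (real (g x))) \<le> ereal (real k)"
    by (auto intro: INF_lower2)
qed

lemma modulator_number_le_iff:
  "modulator_number \<rho> c G \<le> ereal (real k) \<longleftrightarrow> (\<exists>S. modulator \<rho> c G S \<and> card S \<le> k)"
  unfolding modulator_number_def INF_ereal_nat_le_iff by simp

lemma indep_modulator_number_le_iff:
  "indep_modulator_number \<rho> c G \<le> ereal (real k) \<longleftrightarrow>
    (\<exists>S. modulator \<rho> c G S \<and> independence_number (induce G S) \<le> k)"
  unfolding indep_modulator_number_def INF_ereal_nat_le_iff by simp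

text \<open>Replacing an integer bound by \<open>nat k\<close> only enlarges it, and makes the two
  characterisations by natural bounds above applicable.\<close>

lemma has_bounded_nat_iff:
  "has_bounded \<sigma> \<G> \<longleftrightarrow> (\<exists>k::nat. \<forall>G\<in>\<G>. \<forall>S\<subseteq>verts G. \<sigma> (induce G S) \<le> ereal (real k))"
proof
  assume "has_bounded \<sigma> \<G>"
  then obtain k :: int
    where k: "\<forall>G\<in>\<G>. \<forall>S\<subseteq>verts G. \<sigma> (induce G S) \<le> ereal (real_of_int k)"
    unfolding has_bounded_def by blast
  have "ereal (real_of_int k) \<le> ereal (real (nat k))"
    by simp
  with k show "\<exists>k::nat. \<forall>G\<in>\<G>. \<forall>S\<subseteq>verts G. \<sigma> (induce G S) \<le> ereal (real k)"
    by (meson order_trans)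
next
  assume "\<exists>k::nat. \<forall>G\<in>\<G>. \<forall>S\<subseteq>verts G. \<sigma> (induce G S) \<le> ereal (real k)"
  then show "has_bounded \<sigma> \<G>"
    unfolding has_bounded_def by (metis of_int_of_nat_eq)
qed

text \<open>The forward direction for a single graph. The bound \<open>f n\<close> does not depend
  on \<open>H\<close>, so it is uniform over the class.\<close>

lemma indep_modulator_number_le:
  fixes f :: "nat \<Rightarrow> nat"
  assumes H: "fin_graph H"
    and clique: "\<And>G K. fin_graph G \<Longrightarrow> \<rho> G \<le> ereal (real_of_int c) \<Longrightarrow> K \<subseteq> verts G \<Longrightarrow>
      clique K (edges G) \<Longrightarrow> card K < n"
    and "mono f"
    and f: "\<And>S. S \<subseteq> verts H \<Longrightarrow>
      modulator_number \<rho> c (induce H S) \<le> ereal (real (f (clique_number (induce H S))))"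
  shows "indep_modulator_number \<rho> c H \<le> ereal (real (f n))"
proof -
  have fin: "finite (verts H)"
    using H by (simp add: fin_graph_def)
  define \<J> where "\<J> = {J. J \<subseteq> verts H \<and> \<rho> (induce H J) \<le> ereal (real_of_int c)}"
  have "finite \<J>"
    unfolding \<J>_def using fin by simp
  \<comment> \<open>The finite bound for \<open>H\<close> itself excludes the value \<infinity>, so
    some modulator exists and \<open>\<J>\<close> is nonempty.\<close>
  obtain S where "modulator \<rho> c (induce H (verts H)) S"
    using f[of "verts H"] by (auto simp: modulator_number_le_iff)
  then have "verts H - S \<in> \<J>"
    by (simp add: modulator_def \<J>_def induce_induce)
  with \<open>finite \<J>\<close> obtain J where J: "J \<in> \<J>" and max: "\<And>J'. J' \<in> \<J> \<Longrightarrow> card J' \<le> card J"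
    using Max_in[of "card ` \<J>"] Max_ge[of "card ` \<J>"] by fastforce
  have JH: "J \<subseteq> verts H" and \<rho>J: "\<rho> (induce H J) \<le> ereal (real_of_int c)"
    using J by (auto simp: \<J>_def)
  have "card I \<le> f n" if I: "I \<subseteq> verts H - J" "indep I (edges H)" for I
  proof -
    have UH: "I \<union> J \<subseteq> verts H"
      using I JH by blast
    have finIJ: "finite I" "finite J"
      using UH fin by (auto intro: finite_subset)
    have "clique_number (induce H (I \<union> J)) \<le> n"
    proof (rule clique_number_le)
      fix K assume K: "K \<subseteq> verts (induce H (I \<union> J))" "clique K (edges (induce H (I \<union> J)))"
      then have KH: "K \<subseteq> I \<union> J" "clique K (edges H)"
        by (simp_all add: clique_induce)
      have "clique (K \<inter> J) (edges (induce H J))"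
        using KH by (subst clique_induce) (auto simp: clique_def)
      then have "card (K \<inter> J) < n"
        using clique[OF fin_graph_induce[OF H JH] \<rho>J] by simp
      \<comment> \<open>Two distinct vertices here would be both adjacent and nonadjacent. The
        strict bound on \<open>K \<inter> J\<close> absorbs the one extra vertex, so the total is at
        most \<open>n\<close>.\<close>
      moreover have "card (K \<inter> I) \<le> Suc 0"
        using KH(2) I(2) finIJ by (subst card_le_Suc0_iff_eq) (auto simp: clique_def indep_def)
      moreover have "card K \<le> card (K \<inter> I) + card (K \<inter> J)"
        using KH(1) card_Un_le[of "K \<inter> I" "K \<inter> J"] by (simp add: Int_Un_distrib[symmetric] Int_absorb2)
      ultimately show "card K \<le> n"
        by linarith
    qed (use finIJ in simp)
    then have "f (clique_number (induce H (I \<union> J))) \<le> f n"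
      using \<open>mono f\<close> by (rule monoD[rotated])
    then have "modulator_number \<rho> c (induce H (I \<union> J)) \<le> ereal (real (f n))"
      using f[OF UH] by (meson ereal_less_eq(3) of_nat_le_iff order_trans)
    then obtain M where M: "modulator \<rho> c (induce H (I \<union> J)) M" "card M \<le> f n"
      by (auto simp: modulator_number_le_iff)
    \<comment> \<open>The set \<open>I \<union> J - M\<close> competes with \<open>J\<close>, hence
      |I| + |J| - |M| \<le> |J| and |I| \<le> |M|. This survives truncated subtraction.\<close>
    then have MU: "M \<subseteq> I \<union> J" and "I \<union> J - M \<in> \<J>"
      using UH by (auto simp: modulator_def \<J>_def induce_induce)
    then have "card (I \<union> J - M) \<le> card J"
      using max by blast
    moreover have "card (I \<union> J - M) = card (I \<union> J) - card M"
      using MU finIJ by (intro card_Diff_subset) (auto intro: finite_subset)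
    moreover have "card (I \<union> J) = card I + card J"
      using I finIJ by (intro card_Un_disjoint) auto
    ultimately show "card I \<le> f n"
      using M(2) by linarith
  qed
  then have "independence_number (induce H (verts H - J)) \<le> f n"
    using fin by (intro independence_number_le) (simp_all add: indep_induce)
  moreover have "verts H - (verts H - J) = J"
    using JH by blast
  then have "modulator \<rho> c H (verts H - J)"
    using \<rho>J by (simp add: modulator_def)
  ultimately show ?thesis
    by (auto simp: indep_modulator_number_le_iff)
qed

text \<open>A graph with neither a clique of \<open>w + 1\<close> vertices nor an independent set of
  \<open>k + 1\<close> vertices is smaller than any Ramsey bound for this pair.\<close>

lemma ramsey_card_bound:
  fixes k :: nat
  obtains f :: "nat \<Rightarrow> nat" where "mono f"
    and "\<And>(G :: 'a graph) w. fin_graph G \<Longrightarrow> independence_number G \<le> k \<Longrightarrow> clique_number G \<le> w \<Longrightarrow>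
      card (verts G) \<le> f w"
proof -
  have "\<exists>r. \<forall>(V :: 'a set) E. finite V \<and> r \<le> card V \<longrightarrow>
      (\<exists>R\<subseteq>V. card R = Suc w \<and> clique R E \<or> card R = Suc k \<and> indep R E)" for w
    using ramsey2[of "Suc w" "Suc k"] by blast
  then obtain r where r: "\<And>w (V :: 'a set) E. finite V \<Longrightarrow> r w \<le> card V \<Longrightarrow>
      \<exists>R\<subseteq>V. card R = Suc w \<and> clique R E \<or> card R = Suc k \<and> indep R E"
    by metis
  show thesis
  proof
    \<comment> \<open>The bounds \<open>r w\<close> come from a choice and need not be monotone in
      \<open>w\<close>; their partial sums are, and they dominate \<open>r w\<close>.\<close>
    show "mono (\<lambda>w. \<Sum>i\<le>w. r i)"
      by (intro monoI sum_mono2) auto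
    fix G :: "'a graph" and w
    assume G: "fin_graph G" "independence_number G \<le> k" "clique_number G \<le> w"
    have fin: "finite (verts G)"
      using G(1) by (simp add: fin_graph_def)
    have "card (verts G) < r w"
    proof (rule ccontr)
      assume "\<not> card (verts G) < r w"
      then obtain R where "R \<subseteq> verts G"
        and "card R = Suc w \<and> clique R (edges G) \<or> card R = Suc k \<and> indep R (edges G)"
        using r[OF fin] by (meson not_less)
      then show False
        using G(2,3) card_le_clique_number[OF fin] card_le_independence_number[OF fin]
        by (metis Suc_n_not_le_n order_trans)
    qed
    also have "r w \<le> (\<Sum>i\<le>w. r i)"
      by (intro member_le_sum) auto
    finally show "card (verts G) \<le> (\<Sum>i\<le>w. r i)"
      by simp
  qed
qed

theorem theorem5p7:
  fixes \<rho> :: "('a::infinite) graph \<Rightarrow> ereal" and c :: int and \<G> :: "'a graph set"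
  assumes "graph_parameter \<rho>" and "heavy \<rho>" and "graph_class \<G>"
  shows "has_clique_bounded (modulator_number \<rho> c) \<G> \<longleftrightarrow>
         has_bounded (indep_modulator_number \<rho> c) \<G>"
proof
  assume "has_clique_bounded (modulator_number \<rho> c) \<G>"
  then obtain f :: "nat \<Rightarrow> nat" where "mono f"
    and f: "\<And>G S. G \<in> \<G> \<Longrightarrow> S \<subseteq> verts G \<Longrightarrow>
      modulator_number \<rho> c (induce G S) \<le> ereal (real (f (clique_number (induce G S))))"
    unfolding has_clique_bounded_def by blast
  obtain n where n: "\<And>G K. fin_graph G \<Longrightarrow> \<rho> G \<le> ereal (real_of_int c) \<Longrightarrow> K \<subseteq> verts G \<Longrightarrow>
      clique K (edges G) \<Longrightarrow> card K < n"
    using heavy_clique_bound[OF assms(1,2)] by blast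
  have "indep_modulator_number \<rho> c (induce G S) \<le> ereal (real (f n))"
    if "G \<in> \<G>" "S \<subseteq> verts G" for G S
  \<comment> \<open>The lemma is applied to \<open>induce G S\<close>, whose induced subgraphs are
    again induced subgraphs of \<open>G\<close>.\<close>
  proof (rule indep_modulator_number_le[OF _ n \<open>mono f\<close>])
    show "fin_graph (induce G S)"
      using assms(3) that fin_graph_induce unfolding graph_class_def by blast
    show "modulator_number \<rho> c (induce (induce G S) T)
        \<le> ereal (real (f (clique_number (induce (induce G S) T))))"
      if "T \<subseteq> verts (induce G S)" for T
      using f[of G T] that \<open>G \<in> \<G>\<close> \<open>S \<subseteq> verts G\<close> by (simp add: induce_induce)
  qed
  then show "has_bounded (indep_modulator_number \<rho> c) \<G>"
    unfolding has_bounded_nat_iff by blast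
next
  assume "has_bounded (indep_modulator_number \<rho> c) \<G>"
  then obtain k :: nat where k: "\<And>G S. G \<in> \<G> \<Longrightarrow> S \<subseteq> verts G \<Longrightarrow>
      indep_modulator_number \<rho> c (induce G S) \<le> ereal (real k)"
    unfolding has_bounded_nat_iff by blast
  obtain f :: "nat \<Rightarrow> nat" where "mono f"
    and f: "\<And>(G :: 'a graph) w. fin_graph G \<Longrightarrow> independence_number G \<le> k \<Longrightarrow>
      clique_number G \<le> w \<Longrightarrow> card (verts G) \<le> f w"
    using ramsey_card_bound[of k] by blast
  have "modulator_number \<rho> c (induce G S) \<le> ereal (real (f (clique_number (induce G S))))"
    if "G \<in> \<G>" "S \<subseteq> verts G" for G S
  proof -
    have fin: "fin_graph (induce G S)"
      using assms(3) that fin_graph_induce unfolding graph_class_def by blast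
    then have "finite S"
      by (simp add: fin_graph_def)
    obtain M where M: "modulator \<rho> c (induce G S) M"
      and \<alpha>M: "independence_number (induce (induce G S) M) \<le> k"
      using k[OF \<open>G \<in> \<G>\<close> \<open>S \<subseteq> verts G\<close>] by (auto simp: indep_modulator_number_le_iff)
    have MS: "M \<subseteq> S"
      using M by (simp add: modulator_def)
    \<comment> \<open>Since \<open>M\<close> lies in \<open>S\<close>, the Ramsey bound for the
      graph induced by \<open>M\<close> can be used with \<open>w\<close> the clique number of the
      graph induced by \<open>S\<close>, as clique-boundedness demands.\<close>
    have "clique_number (induce G M) \<le> clique_number (induce G S)"
    proof (rule clique_number_le)
      fix K assume "K \<subseteq> verts (induce G M)" "clique K (edges (induce G M))"
      then have "K \<subseteq> S" "clique K (edges (induce G S))"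
        using MS by (auto simp: clique_induce)
      then show "card K \<le> clique_number (induce G S)"
        using \<open>finite S\<close> by (intro card_le_clique_number) auto
    qed (use MS \<open>finite S\<close> in \<open>auto intro: finite_subset\<close>)
    moreover have "fin_graph (induce G M)"
      using fin_graph_induce[OF fin, of M] MS by (simp add: induce_induce)
    ultimately have "card M \<le> f (clique_number (induce G S))"
      using f[of "induce G M"] \<alpha>M MS by (simp add: induce_induce)
    with M show ?thesis
      by (auto simp: modulator_number_le_iff)
  qed
  then show "has_clique_bounded (modulator_number \<rho> c) \<G>"
    unfolding has_clique_bounded_def using \<open>mono f\<close> by blast
qed

end
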